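(* Let $b\in\{0,1\}^{\mathbb{Z}}$. If $\mathbf 0\in X_b$ and $\mathbf 1\in X_b$, then $$W(A_b)=\mathrm{conv}\bigl(W(A_{\mathbf 0})\cup W(A_{\mathbf 1})\bigr).$$
   Context: For a biinfinite sequence $b=(b_i)_{i\in\mathbb{Z}}\in\{0,1\}^{\mathbb{Z}}$, $A_b\colon \ell^2(\mathbb{Z})\to\ell^2(\mathbb{Z})$ (complex scalars) denotes the bounded tridiagonal operator $(A_bx)_k=b_{k-1}x_{k-1}+x_{k+1}$ for $k\in\mathbb{Z}$. $\mathbf 0$ and $\mathbf 1$ denote the constant biinfinite sequences with all entries $0$ and all entries $1$, respectively. The numerical range of an operator $A$ on $\ell^2(\mathbb{Z})$ is $W(A)=\{\langle Ax,x\rangle : x\in\ell^2(\mathbb{Z}),\ \|x\|=1\}$, where $\langle x,y\rangle=\sum_{k}x_k\overline{y_k}$. $\mathrm{conv}(S)$ is the convex hull of $S\subset\mathbb{C}$ (no closure taken). The shift map $\varphi$ on $\{0,1\}^{\mathbb{Z}}$ is $\varphi(b)_i=b_{i+1}$; the orbit of $b$ is $\mathrm{orb}(b)=\{\varphi^n(b):n\in\mathbb{Z}\}$; the subshift generated by $b$ is $X_b=\overline{\mathrm{orb}(b)}$, the closure in $\{0,1\}^{\mathbb{Z}}$ with the product topology of the discrete topology (equivalently, two sequences are close when they agree on a long central block of coordinates $[-k,k]$). *)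

theory Defs
  imports "HOL-Analysis.Analysis"
begin

definition ell2 :: "(int \<Rightarrow> complex) set" where
  "ell2 = {x. (\<lambda>k. (cmod (x k))\<^sup>2) summable_on UNIV}"

definition ell2_inner :: "(int \<Rightarrow> complex) \<Rightarrow> (int \<Rightarrow> complex) \<Rightarrow> complex" where
  "ell2_inner x y = (\<Sum>\<^sub>\<infinity>k. x k * cnj (y k))"

definition ell2_norm :: "(int \<Rightarrow> complex) \<Rightarrow> real" where
  "ell2_norm x = sqrt (\<Sum>\<^sub>\<infinity>k. (cmod (x k))\<^sup>2)"

text \<open>Operators on \<open>ell2\<close> are functions on all biinfinite sequences of which only the
  restriction to \<open>ell2\<close> matters.\<close>

definition numerical_range :: "((int \<Rightarrow> complex) \<Rightarrow> (int \<Rightarrow> complex)) \<Rightarrow> complex set" where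
  "numerical_range A = {ell2_inner (A x) x | x. x \<in> ell2 \<and> ell2_norm x = 1}"

definition tridiag_op :: "(int \<Rightarrow> nat) \<Rightarrow> (int \<Rightarrow> complex) \<Rightarrow> (int \<Rightarrow> complex)" where
  "tridiag_op b x = (\<lambda>k. of_nat (b (k - 1)) * x (k - 1) + x (k + 1))"

definition shift :: "(int \<Rightarrow> nat) \<Rightarrow> (int \<Rightarrow> nat)" where
  "shift b = (\<lambda>i. b (i + 1))"

definition shift_power :: "int \<Rightarrow> (int \<Rightarrow> nat) \<Rightarrow> (int \<Rightarrow> nat)" where
  "shift_power n = (if n \<ge> 0 then shift ^^ nat n else inv shift ^^ nat (- n))"

definition orbit :: "(int \<Rightarrow> nat) \<Rightarrow> (int \<Rightarrow> nat) set" where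
  "orbit b = range (\<lambda>n. shift_power n b)"

definition binary_topology :: "(int \<Rightarrow> nat) topology" where
  "binary_topology = product_topology (\<lambda>_. discrete_topology {0, 1}) UNIV"

definition subshift :: "(int \<Rightarrow> nat) \<Rightarrow> (int \<Rightarrow> nat) set" where
  "subshift b = binary_topology closure_of orbit b"

lemma topspace_binary_topology: "topspace binary_topology = {b. range b \<subseteq> {0, 1}}"
  by (auto simp: binary_topology_def PiE_def Pi_def image_subset_iff simp del: One_nat_def)

lemma shift_power_apply: "shift_power n b i = b (i + n)"
proof -
  have 1: "(shift ^^ m) c j = c (j + int m)" for m c j
    by (induction m arbitrary: j) (auto simp: shift_def algebra_simps)
  have inv_shift: "inv shift = (\<lambda>c i. c (i - 1))"
    by (rule inv_equality) (auto simp: shift_def)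
  have 2: "(inv shift ^^ m) c j = c (j - int m)" for m c j
    by (induction m arbitrary: j) (auto simp: inv_shift algebra_simps)
  show ?thesis by (auto simp: shift_power_def 1 2)
qed

lemma orbit_subset_topspace:
  assumes "range b \<subseteq> {0, 1}"
  shows "orbit b \<subseteq> topspace binary_topology"
  using assms
  by (auto simp: orbit_def topspace_binary_topology shift_power_apply image_subset_iff
      simp del: One_nat_def)

lemma ell2_add:
  assumes "x \<in> ell2" "y \<in> ell2"
  shows "(\<lambda>k. x k + y k) \<in> ell2"
proof -
  have "(\<lambda>k. 2 * (cmod (x k))\<^sup>2 + 2 * (cmod (y k))\<^sup>2) summable_on UNIV"
    using assms unfolding ell2_def
    by (intro summable_on_add summable_on_cmult_right) auto
  moreover have "(cmod (x k + y k))\<^sup>2 \<le> 2 * (cmod (x k))\<^sup>2 + 2 * (cmod (y k))\<^sup>2" for k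
  proof -
    have "(cmod (x k + y k))\<^sup>2 \<le> (cmod (x k) + cmod (y k))\<^sup>2"
      by (intro power_mono norm_triangle_ineq) auto
    also have "\<dots> \<le> 2 * (cmod (x k))\<^sup>2 + 2 * (cmod (y k))\<^sup>2"
      using sum_squares_bound[of "cmod (x k)" "cmod (y k)"] by (simp add: power2_sum)
    finally show ?thesis .
  qed
  ultimately show ?thesis
    unfolding ell2_def by (auto intro: summable_on_comparison_test)
qed

lemma ell2_translate:
  assumes "x \<in> ell2"
  shows "(\<lambda>k. x (k + n)) \<in> ell2"
proof -
  have bij: "bij_betw (\<lambda>k::int. k + n) UNIV UNIV"
    by (rule bij_betwI[where g = "\<lambda>k. k - n"]) auto
  show ?thesis
    using assms summable_on_reindex_bij_betw[OF bij, of "\<lambda>k. (cmod (x k))\<^sup>2"]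
    by (simp add: ell2_def)
qed

lemma tridiag_op_ell2:
  assumes "range b \<subseteq> {0, 1}" "x \<in> ell2"
  shows "tridiag_op b x \<in> ell2"
proof -
  have "(\<lambda>k. of_nat (b k) * x k) \<in> ell2"
  proof -
    have b: "b k = 0 \<or> b k = 1" for k using assms(1) by auto
    have "(cmod (of_nat (b k) * x k))\<^sup>2 \<le> (cmod (x k))\<^sup>2" for k
      using b[of k] by auto
    then show ?thesis
      using assms(2) unfolding ell2_def
      by (auto intro: summable_on_comparison_test)
  qed
  from ell2_add[OF ell2_translate[OF this, of "-1"] ell2_translate[OF assms(2), of 1]]
  show ?thesis by (simp add: tridiag_op_def)
qed

lemma ell2_inner_summable:
  assumes "x \<in> ell2" "y \<in> ell2"
  shows "(\<lambda>k. x k * cnj (y k)) summable_on UNIV"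
proof -
  have "(\<lambda>k. (cmod (x k))\<^sup>2 + (cmod (y k))\<^sup>2) summable_on UNIV"
    using assms unfolding ell2_def by (intro summable_on_add) auto
  moreover have "cmod (x k * cnj (y k)) \<le> (cmod (x k))\<^sup>2 + (cmod (y k))\<^sup>2" for k
  proof -
    have "0 \<le> cmod (x k) * cmod (y k)" by simp
    with sum_squares_bound[of "cmod (x k)" "cmod (y k)"]
    have "cmod (x k) * cmod (y k) \<le> (cmod (x k))\<^sup>2 + (cmod (y k))\<^sup>2" by linarith
    then show ?thesis by (simp add: norm_mult)
  qed
  ultimately have "(\<lambda>k. norm (x k * cnj (y k))) summable_on UNIV"
    by (auto intro: summable_on_comparison_test)
  then show ?thesis by (rule abs_summable_summable)
qed

end

theory Submission
  imports Defs
begin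

text \<open>
  Grouping the terms of \<open>\<langle>A\<^sub>b x, x\<rangle>\<close> by the edges \<open>{k, k + 1}\<close> of \<open>\<int>\<close> instead of by rows gives
  \<open>\<langle>A\<^sub>b x, x\<rangle> = (\<Sum>k. s\<^sub>k + b\<^sub>k * cnj s\<^sub>k)\<close> with \<open>s\<^sub>k = x\<^sub>k\<^sub>+\<^sub>1 * cnj x\<^sub>k\<close>: an edge with
  \<open>b\<^sub>k = 0\<close> contributes the complex number \<open>s\<^sub>k\<close>, and one with \<open>b\<^sub>k = 1\<close> the real number
  \<open>2 Re s\<^sub>k\<close>. Everything follows from two facts about the edge products \<open>s\<^sub>k\<close>.

  For a unit vector \<open>(\<Sum>k. \<bar>s\<^sub>k\<bar>) < 1\<close> strictly, because equality in the arithmetic-geometric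
  mean inequality on every edge would make \<open>\<bar>x\<^sub>k\<bar>\<close> constant on \<open>\<int>\<close>
  (\<open>sum_norm_edge_product_less_1\<close>). Conversely, every \<open>u\<close> in the open unit disc is
  \<open>\<Sum>k. s\<^sub>k\<close> for a finitely supported unit vector, which can be placed anywhere on \<open>\<int>\<close>
  (\<open>finitely_supported_unit_vector\<close>). Hence \<open>W(A\<^sub>0)\<close> is the open unit disc and \<open>W(A\<^sub>1)\<close> the
  open real segment from \<open>-2\<close> to \<open>2\<close>.

  Splitting the sum over the edges by the value of \<open>b\<^sub>k\<close> puts each point of \<open>W(A\<^sub>b)\<close> into the
  convex hull. In the other direction, the constant sequences lie in \<open>X\<^sub>b\<close> only if \<open>b\<close>
  contains arbitrarily long blocks of zeros and of ones (\<open>long_constant_blocks\<close>). A convex combination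
  \<open>t u + (1 - t) v\<close> is then attained at \<open>\<surd>t x + \<surd>(1 - t) y\<close>, where \<open>x\<close> is a vector for \<open>u\<close>
  living inside a block of zeros and \<open>y\<close> one for \<open>v\<close> inside a block of ones: no edge joins the
  two supports, so the quadratic form is additive.
\<close>

section \<open>The numerical range as sums over edges\<close>

definition edge_product :: "(int \<Rightarrow> complex) \<Rightarrow> int \<Rightarrow> complex" where
  "edge_product x k = x (k + 1) * cnj (x k)"

lemma has_sum_int_translate:
  "((\<lambda>k::int. f (k + n)) has_sum S) UNIV \<longleftrightarrow> (f has_sum S) UNIV"
proof (rule has_sum_reindex_bij_betw)
  show "bij_betw (\<lambda>k::int. k + n) UNIV UNIV"
    by (rule bij_betwI[where g = "\<lambda>k. k - n"]) auto
qed

lemma has_sum_edge_form: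
  assumes "range b \<subseteq> {0, 1}" "x \<in> ell2"
  shows "((\<lambda>k. edge_product x k + of_nat (b k) * cnj (edge_product x k))
           has_sum ell2_inner (tridiag_op b x) x) UNIV"
proof -
  define upper where "upper = (\<lambda>k. x (k + 1) * cnj (x k))"
  define lower where "lower = (\<lambda>k. of_nat (b (k - 1)) * x (k - 1) * cnj (x k))"
  have total: "((\<lambda>k. lower k + upper k) has_sum ell2_inner (tridiag_op b x) x) UNIV"
    using has_sum_infsum[OF ell2_inner_summable[OF tridiag_op_ell2[OF assms] assms(2)]]
    unfolding ell2_inner_def
    by (simp add: tridiag_op_def upper_def lower_def algebra_simps)
  obtain d where d: "(upper has_sum d) UNIV"
    using ell2_inner_summable[OF ell2_translate[OF assms(2), of 1] assms(2)]
    unfolding upper_def summable_on_def by blast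
  have "(lower has_sum (ell2_inner (tridiag_op b x) x - d)) UNIV"
    using has_sum_add[OF total has_sum_uminusI[OF d]] by simp
  then have "((\<lambda>k. lower (k + 1)) has_sum (ell2_inner (tridiag_op b x) x - d)) UNIV"
    by (subst has_sum_int_translate)
  from has_sum_add[OF d this] show ?thesis
    by (simp add: upper_def lower_def edge_product_def mult_ac)
qed

lemma mem_numerical_range_iff:
  assumes "range b \<subseteq> {0, 1}"
  shows "w \<in> numerical_range (tridiag_op b) \<longleftrightarrow>
    (\<exists>x. ((\<lambda>k. (cmod (x k))\<^sup>2) has_sum 1) UNIV \<and>
      ((\<lambda>k. edge_product x k + of_nat (b k) * cnj (edge_product x k)) has_sum w) UNIV)"
proof -
  have unit: "x \<in> ell2 \<and> ell2_norm x = 1 \<longleftrightarrow> ((\<lambda>k. (cmod (x k))\<^sup>2) has_sum 1) UNIV" for x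
    by (auto simp: ell2_def ell2_norm_def has_sum_iff)
  show ?thesis
  proof
    assume "w \<in> numerical_range (tridiag_op b)"
    then show "\<exists>x. ((\<lambda>k. (cmod (x k))\<^sup>2) has_sum 1) UNIV \<and>
      ((\<lambda>k. edge_product x k + of_nat (b k) * cnj (edge_product x k)) has_sum w) UNIV"
      using unit has_sum_edge_form[OF assms] unfolding numerical_range_def by blast
  next
    assume "\<exists>x. ((\<lambda>k. (cmod (x k))\<^sup>2) has_sum 1) UNIV \<and>
      ((\<lambda>k. edge_product x k + of_nat (b k) * cnj (edge_product x k)) has_sum w) UNIV"
    then obtain x where x: "x \<in> ell2" "ell2_norm x = 1"
      and w: "((\<lambda>k. edge_product x k + of_nat (b k) * cnj (edge_product x k)) has_sum w) UNIV"
      using unit by blast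
    have "w = ell2_inner (tridiag_op b x) x"
      using has_sum_unique[OF w has_sum_edge_form[OF assms x(1)]] .
    then show "w \<in> numerical_range (tridiag_op b)"
      using x unfolding numerical_range_def by blast
  qed
qed

section \<open>Edge products of unit vectors\<close>

lemma int_function_constant:
  fixes f :: "int \<Rightarrow> 'a"
  assumes "\<And>k. f (k + 1) = f k"
  shows "f k = f 0"
proof (induction k rule: int_induct[where k = 0])
  case (step1 i) then show ?case using assms[of i] by simp
next
  case (step2 i) then show ?case using assms[of "i - 1"] by simp
qed simp

text \<open>
  On each edge \<open>\<bar>x\<^sub>k\<^sub>+\<^sub>1\<bar> \<bar>x\<^sub>k\<bar> \<le> (\<bar>x\<^sub>k\<^sub>+\<^sub>1\<bar>\<^sup>2 + \<bar>x\<^sub>k\<bar>\<^sup>2) / 2\<close>, and the right-hand sides add up to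
  \<open>1\<close>. The inequality is strict on some edge, since a nonzero constant modulus is not square
  summable over \<open>\<int>\<close>.
\<close>
lemma sum_norm_edge_product_less_1:
  assumes "((\<lambda>k. (cmod (x k))\<^sup>2) has_sum 1) UNIV"
  obtains r where "((\<lambda>k. cmod (edge_product x k)) has_sum r) UNIV" "r < 1"
proof -
  define a where "a k = (cmod (x k))\<^sup>2" for k
  have a: "(a has_sum 1) UNIV"
    using assms by (simp add: a_def[abs_def])
  have "((\<lambda>k. a (k + 1)) has_sum 1) UNIV"
    using a by (subst has_sum_int_translate)
  from has_sum_cmult_right[OF has_sum_add[OF a this], of "1/2"]
  have mean: "((\<lambda>k. (a k + a (k + 1)) / 2) has_sum 1) UNIV"
    by simp
  have gap: "(a k + a (k + 1)) / 2 - cmod (edge_product x k)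
      = (cmod (x (k + 1)) - cmod (x k))\<^sup>2 / 2" for k
    by (simp add: a_def edge_product_def norm_mult power2_eq_square field_simps)
  have le: "cmod (edge_product x k) \<le> (a k + a (k + 1)) / 2" for k
    using gap[of k] zero_le_power2[of "cmod (x (k + 1)) - cmod (x k)"] by linarith
  have "(\<lambda>k. cmod (edge_product x k)) summable_on UNIV"
    using le by (rule summable_on_comparison_test[OF has_sum_imp_summable[OF mean]]) simp
  then obtain r where r: "((\<lambda>k. cmod (edge_product x k)) has_sum r) UNIV"
    unfolding summable_on_def by blast
  have "\<exists>k. cmod (x (k + 1)) \<noteq> cmod (x k)"
  proof (rule ccontr)
    assume "\<not> ?thesis"
    then have "cmod (x k) = cmod (x 0)" for k
      using int_function_constant[of "\<lambda>k. cmod (x k)"] by blast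
    then have const: "a = (\<lambda>_. a 0)"
      by (auto simp: a_def)
    have "a 0 = 0"
    proof (rule ccontr)
      assume "a 0 \<noteq> 0"
      then have "\<not> (\<lambda>_::int. a 0) summable_on UNIV"
        by (intro infsum_diverge_constant) (auto simp: infinite_UNIV_int)
      then show False using a const by (metis summable_on_def)
    qed
    then have "(a has_sum 0) UNIV"
      using const by (metis has_sum_0)
    then show False using has_sum_unique[OF a] by fastforce
  qed
  then obtain k where "cmod (x (k + 1)) - cmod (x k) \<noteq> 0" by auto
  then have "0 < (cmod (x (k + 1)) - cmod (x k))\<^sup>2" by simp
  then have "cmod (edge_product x k) < (a k + a (k + 1)) / 2"
    using gap[of k] by linarith
  then have "r < 1"
    using has_sum_strict_mono[OF r mean] le by blast
  with r that show thesis by blast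
qed

text \<open>
  A plateau of \<open>m + 1\<close> equal entries \<open>\<surd>(\<rho> / m)\<close> has \<open>m\<close> inner edges and hence edge sum \<open>\<rho>\<close>; its
  squared norm \<open>\<rho> + \<rho> / m\<close> is at most \<open>1\<close> for large \<open>m\<close>. An isolated entry supplies the
  missing norm without adding an edge.
\<close>
lemma finitely_supported_real_profile:
  fixes \<rho> :: real
  assumes "0 \<le> \<rho>" "\<rho> < 1"
  obtains g :: "int \<Rightarrow> real" and N :: int
  where "\<And>k. g k \<noteq> 0 \<Longrightarrow> \<bar>k\<bar> < N"
    and "((\<lambda>k. (g k)\<^sup>2) has_sum 1) UNIV"
    and "((\<lambda>k. g (k + 1) * g k) has_sum \<rho>) UNIV"
proof -
  obtain m0 :: nat where m0: "\<rho> / (1 - \<rho>) \<le> real m0"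
    using real_arch_simple by blast
  define m where "m = Suc m0"
  have "\<rho> / (1 - \<rho>) \<le> real m" "0 < real m"
    using m0 by (auto simp: m_def)
  then have m: "\<rho> \<le> real m * (1 - \<rho>)" "0 < real m"
    using assms by (simp_all add: pos_divide_le_eq)
  define c where "c = \<rho> / real m"
  define d where "d = 1 - real (m + 1) * c"
  have c: "c \<ge> 0" "real m * c = \<rho>"
    using assms m by (auto simp: c_def)
  have "real (m + 1) * c \<le> 1"
    using m by (simp add: c_def field_simps)
  then have d: "d \<ge> 0" by (simp add: d_def)
  define g :: "int \<Rightarrow> real" where
    "g k = (if 0 \<le> k \<and> k \<le> int m then sqrt c else if k = int m + 2 then sqrt d else 0)" for k
  show thesis
  proof
    show "\<bar>k\<bar> < int m + 3" if "g k \<noteq> 0" for k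
      using that by (auto simp: g_def split: if_splits)
    have "((\<lambda>_. c) has_sum of_nat (card {0..int m}) * c) {0..int m}"
      by (rule has_sum_constant) simp
    moreover have "((\<lambda>_. c) has_sum of_nat (card {0..int m}) * c) {0..int m} \<longleftrightarrow>
        ((\<lambda>k. (g k)\<^sup>2) has_sum of_nat (card {0..int m}) * c) {0..int m}"
      using c by (intro has_sum_cong) (auto simp: g_def)
    moreover have "((\<lambda>k. (g k)\<^sup>2) has_sum d) {int m + 2}"
      using d by (intro has_sum_finiteI) (auto simp: g_def)
    ultimately have "((\<lambda>k. (g k)\<^sup>2) has_sum (of_nat (card {0..int m}) * c + d))
        ({0..int m} \<union> {int m + 2})"
      by (intro has_sum_Un_disjoint) auto
    moreover have "of_nat (card {0..int m}) * c + d = 1"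
      by (simp add: d_def nat_add_distrib)
    moreover have "((\<lambda>k. (g k)\<^sup>2) has_sum 1) ({0..int m} \<union> {int m + 2}) \<longleftrightarrow>
        ((\<lambda>k. (g k)\<^sup>2) has_sum 1) UNIV"
      by (rule has_sum_cong_neutral) (auto simp: g_def)
    ultimately show "((\<lambda>k. (g k)\<^sup>2) has_sum 1) UNIV" by simp
    have "((\<lambda>_. c) has_sum of_nat (card {0..<int m}) * c) {0..<int m}"
      by (rule has_sum_constant) simp
    moreover have "((\<lambda>_. c) has_sum \<rho>) {0..<int m} \<longleftrightarrow>
        ((\<lambda>k. g (k + 1) * g k) has_sum \<rho>) UNIV"
      using c by (intro has_sum_cong_neutral) (auto simp: g_def)
    ultimately show "((\<lambda>k. g (k + 1) * g k) has_sum \<rho>) UNIV"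
      using c by simp
  qed
qed

text \<open>
  Multiplying the profile by the phases \<open>cis (k * \<theta>)\<close> turns every edge product by the same
  angle \<open>\<theta>\<close>. The radius \<open>N\<close> does not depend on the position \<open>p\<close>, so that a block of length
  about \<open>2 N\<close> can be chosen before the vector is placed there.
\<close>
lemma finitely_supported_unit_vector:
  assumes "cmod u < 1"
  obtains N :: int
  where "\<And>p. \<exists>x. (\<forall>k. x k \<noteq> 0 \<longrightarrow> \<bar>k - p\<bar> < N) \<and>
      ((\<lambda>k. (cmod (x k))\<^sup>2) has_sum 1) UNIV \<and> (edge_product x has_sum u) UNIV"
proof -
  obtain g :: "int \<Rightarrow> real" and N where supp: "\<And>k. g k \<noteq> 0 \<Longrightarrow> \<bar>k\<bar> < N"
    and unit: "((\<lambda>k. (g k)\<^sup>2) has_sum 1) UNIV"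
    and edges: "((\<lambda>k. g (k + 1) * g k) has_sum cmod u) UNIV"
    using finitely_supported_real_profile[OF norm_ge_zero assms] by metis
  have u: "of_real (cmod u) * cis (Arg u) = u"
    using rcis_cmod_Arg[of u] by (simp add: rcis_def)
  show thesis
  proof
    fix p :: int
    define x where "x k = of_real (g (k + (- p))) * cis (of_int k * Arg u)" for k
    have "x k \<noteq> 0 \<longrightarrow> \<bar>k - p\<bar> < N" for k
      using supp[of "k + (- p)"] by (simp add: x_def)
    moreover have "((\<lambda>k. (g (k + (- p)))\<^sup>2) has_sum 1) UNIV"
      using unit has_sum_int_translate[of "\<lambda>k. (g k)\<^sup>2" "- p" 1] by blast
    then have "((\<lambda>k. (cmod (x k))\<^sup>2) has_sum 1) UNIV"
      by (simp add: x_def norm_mult)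
    moreover have "((\<lambda>k. g (k + (- p) + 1) * g (k + (- p))) has_sum cmod u) UNIV"
      using edges has_sum_int_translate[of "\<lambda>k. g (k + 1) * g k" "- p" "cmod u"] by blast
    then have "((\<lambda>k. of_real (g (k + (- p) + 1) * g (k + (- p))) * cis (Arg u))
        has_sum of_real (cmod u) * cis (Arg u)) UNIV"
      by (intro has_sum_cmult_left has_sum_of_real)
    moreover have "edge_product x
        = (\<lambda>k. of_real (g (k + (- p) + 1) * g (k + (- p))) * cis (Arg u))"
    proof
      fix k
      have "cis (of_int (k + 1) * Arg u) * cis (- (of_int k * Arg u)) = cis (Arg u)"
        by (simp add: cis_mult algebra_simps)
      then show "edge_product x k
          = of_real (g (k + (- p) + 1) * g (k + (- p))) * cis (Arg u)"
        by (simp add: edge_product_def x_def cis_cnj algebra_simps)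
    qed
    ultimately show "\<exists>x. (\<forall>k. x k \<noteq> 0 \<longrightarrow> \<bar>k - p\<bar> < N) \<and>
        ((\<lambda>k. (cmod (x k))\<^sup>2) has_sum 1) UNIV \<and> (edge_product x has_sum u) UNIV"
      unfolding u by metis
  qed
qed

section \<open>The two constant sequences\<close>

lemma numerical_range_const_0: "numerical_range (tridiag_op (\<lambda>_. 0)) = ball 0 1"
proof (intro set_eqI iffI)
  fix w :: complex
  assume "w \<in> numerical_range (tridiag_op (\<lambda>_. 0))"
  then obtain x where unit: "((\<lambda>k. (cmod (x k))\<^sup>2) has_sum 1) UNIV"
    and w: "(edge_product x has_sum w) UNIV"
    by (subst (asm) mem_numerical_range_iff) auto
  show "w \<in> ball 0 1"
  proof -
    obtain r where "((\<lambda>k. cmod (edge_product x k)) has_sum r) UNIV" "r < 1"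
      using sum_norm_edge_product_less_1[OF unit] .
    then have "cmod w < 1"
      using norm_has_sum_bound[OF _ w] by (meson le_less_trans)
    then show ?thesis by simp
  qed
next
  fix w :: complex
  assume "w \<in> ball 0 1"
  then have "cmod w < 1" by simp
  then obtain x where "((\<lambda>k. (cmod (x k))\<^sup>2) has_sum 1) UNIV" "(edge_product x has_sum w) UNIV"
    using finitely_supported_unit_vector by metis
  then show "w \<in> numerical_range (tridiag_op (\<lambda>_. 0))"
    by (subst mem_numerical_range_iff) auto
qed

lemma numerical_range_const_1: "numerical_range (tridiag_op (\<lambda>_. 1)) = of_real ` {-2<..<2}"
proof -
  have mem: "w \<in> numerical_range (tridiag_op (\<lambda>_. 1)) \<longleftrightarrow>
    (\<exists>x. ((\<lambda>k. (cmod (x k))\<^sup>2) has_sum 1) UNIV \<and>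
      ((\<lambda>k. edge_product x k + cnj (edge_product x k)) has_sum w) UNIV)" for w
    using mem_numerical_range_iff[of "\<lambda>_. 1" w] by simp
  show ?thesis
  proof (intro set_eqI iffI)
    fix w :: complex
    assume "w \<in> numerical_range (tridiag_op (\<lambda>_. 1))"
    then obtain x where unit: "((\<lambda>k. (cmod (x k))\<^sup>2) has_sum 1) UNIV"
      and w: "((\<lambda>k. edge_product x k + cnj (edge_product x k)) has_sum w) UNIV"
      unfolding mem by blast
    obtain r where r: "((\<lambda>k. cmod (edge_product x k)) has_sum r) UNIV" "r < 1"
      using sum_norm_edge_product_less_1[OF unit] .
    then have "edge_product x summable_on UNIV"
      by (metis abs_summable_summable summable_on_def)
    then obtain S where S: "(edge_product x has_sum S) UNIV"
      unfolding summable_on_def by blast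
    then have "((\<lambda>k. edge_product x k + cnj (edge_product x k)) has_sum (S + cnj S)) UNIV"
      by (intro has_sum_add) simp_all
    then have "w = S + cnj S"
      using has_sum_unique[OF w] by blast
    then have "w = of_real (2 * Re S)"
      unfolding complex_add_cnj .
    moreover have "\<bar>Re S\<bar> < 1"
      using norm_has_sum_bound[OF r(1) S] r(2) abs_Re_le_cmod[of S] by linarith
    then have "2 * Re S \<in> {-2<..<2}"
      by (simp add: abs_less_iff)
    ultimately show "w \<in> of_real ` {-2<..<2}" by (rule image_eqI)
  next
    fix w :: complex
    assume "w \<in> of_real ` {-2<..<2}"
    then obtain v where v: "w = of_real v" "-2 < v" "v < 2" by auto
    then have "\<bar>v / 2\<bar> < 1" by simp
    then have "cmod (of_real (v / 2)) < 1" unfolding norm_of_real .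
    then obtain x where unit: "((\<lambda>k. (cmod (x k))\<^sup>2) has_sum 1) UNIV"
      and S: "(edge_product x has_sum of_real (v / 2)) UNIV"
      using finitely_supported_unit_vector by metis
    have "((\<lambda>k. cnj (edge_product x k)) has_sum cnj (of_real (v / 2))) UNIV"
      using S by (subst has_sum_cnj_iff)
    from has_sum_add[OF S this]
    have "((\<lambda>k. edge_product x k + cnj (edge_product x k)) has_sum w) UNIV"
      by (simp add: v)
    then show "w \<in> numerical_range (tridiag_op (\<lambda>_. 1))"
      using unit unfolding mem by blast
  qed
qed

section \<open>The upper bound\<close>

text \<open>
  Let \<open>P\<close> and \<open>R\<close> be the parts of \<open>\<Sum>k. \<bar>s\<^sub>k\<bar>\<close> over the edges with \<open>b\<^sub>k = 0\<close> and \<open>b\<^sub>k = 1\<close>.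
  The corresponding parts of \<open>\<langle>A\<^sub>b x, x\<rangle>\<close> are bounded by \<open>P\<close> and \<open>2 R\<close>. Because \<open>P + R < 1\<close>,
  weights \<open>t > P\<close> and \<open>1 - t > R\<close> exist, and division by them lands strictly inside the disc
  and the segment.
\<close>
lemma numerical_range_subset_convex_hull:
  assumes "range b \<subseteq> {0, 1}"
  shows "numerical_range (tridiag_op b) \<subseteq> convex hull (ball 0 1 \<union> of_real ` {-2<..<2})"
proof
  fix w assume "w \<in> numerical_range (tridiag_op b)"
  then obtain x where unit: "((\<lambda>k. (cmod (x k))\<^sup>2) has_sum 1) UNIV"
    and w: "((\<lambda>k. edge_product x k + of_nat (b k) * cnj (edge_product x k)) has_sum w) UNIV"
    using mem_numerical_range_iff[OF assms] by blast
  obtain r where r: "((\<lambda>k. cmod (edge_product x k)) has_sum r) UNIV" "r < 1"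
    using sum_norm_edge_product_less_1[OF unit] .
  define Z where "Z = {k. b k = 0}"
  have b: "b k = 1" if "k \<in> - Z" for k
    using that subsetD[OF assms, of "b k"] by (simp add: Z_def)
  have parts: "\<exists>S R. (edge_product x has_sum S) A \<and>
      ((\<lambda>k. cmod (edge_product x k)) has_sum R) A \<and> cmod S \<le> R" for A
  proof -
    have abs: "(\<lambda>k. cmod (edge_product x k)) summable_on A"
      using r(1) summable_on_subset by (metis subset_UNIV summable_on_def)
    then have "edge_product x summable_on A"
      by (rule abs_summable_summable)
    with abs show ?thesis
      using norm_has_sum_bound unfolding summable_on_def by blast
  qed
  obtain p P where p: "(edge_product x has_sum p) Z"
    and P: "((\<lambda>k. cmod (edge_product x k)) has_sum P) Z" and pP: "cmod p \<le> P"
    using parts by blast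
  obtain q R where q: "(edge_product x has_sum q) (- Z)"
    and R: "((\<lambda>k. cmod (edge_product x k)) has_sum R) (- Z)" and qR: "cmod q \<le> R"
    using parts by blast
  have "P + R = r"
    using has_sum_unique[OF has_sum_Un_disjoint[OF P R]] r(1) by simp
  then have PR: "P + R < 1" using r(2) by simp
  have "((\<lambda>k. edge_product x k + of_nat (b k) * cnj (edge_product x k)) has_sum p) Z"
    using p by (rule has_sum_cong[THEN iffD1, rotated]) (simp add: Z_def)
  moreover have "((\<lambda>k. edge_product x k + cnj (edge_product x k)) has_sum (q + cnj q)) (- Z)"
    using q by (intro has_sum_add) simp_all
  then have "((\<lambda>k. edge_product x k + of_nat (b k) * cnj (edge_product x k))
      has_sum (q + cnj q)) (- Z)"
    by (rule has_sum_cong[THEN iffD1, rotated]) (simp add: b)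
  ultimately have "((\<lambda>k. edge_product x k + of_nat (b k) * cnj (edge_product x k))
      has_sum (p + (q + cnj q))) (Z \<union> - Z)"
    by (rule has_sum_Un_disjoint) simp
  then have "w = p + (q + cnj q)"
    using has_sum_unique[OF w] by (simp only: Compl_partition)
  then have w_eq: "w = p + of_real (2 * Re q)"
    by (simp only: complex_add_cnj)
  \<comment> \<open>The slack \<open>1 - P - R\<close> is shared equally between the two weights.\<close>
  define t where "t = P + (1 - P - R) / 2"
  have "P \<ge> 0" "R \<ge> 0"
    using pP qR norm_ge_zero order_trans by blast+
  then have t: "0 < t" "P < t" "0 < 1 - t" "R < 1 - t"
    using PR by (auto simp: t_def field_simps)
  have "cmod (p / of_real t) < 1"
    using t pP by (simp add: norm_divide)
  then have u: "p / of_real t \<in> ball 0 1" by simp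
  have "\<bar>Re q\<bar> < 1 - t"
    using abs_Re_le_cmod[of q] qR t by linarith
  then have "\<bar>2 * Re q / (1 - t)\<bar> < 2"
    using t by (simp add: abs_mult pos_divide_less_eq)
  then have "2 * Re q / (1 - t) \<in> {-2<..<2}"
    unfolding abs_less_iff greaterThanLessThan_iff by linarith
  then have v: "of_real (2 * Re q / (1 - t)) \<in> complex_of_real ` {-2<..<2}"
    by (rule imageI)
  have "t *\<^sub>R (p / of_real t) + (1 - t) *\<^sub>R of_real (2 * Re q / (1 - t))
      \<in> convex hull (ball 0 1 \<union> of_real ` {-2<..<2})"
    using u v t by (intro convexD[OF convex_convex_hull] hull_inc) auto
  moreover have "t *\<^sub>R (p / of_real t) = p"
    using t by (simp add: scaleR_conv_of_real)
  moreover have "(1 - t) *\<^sub>R complex_of_real (2 * Re q / (1 - t)) = of_real (2 * Re q)"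
    using t by (simp only: scaleR_conv_of_real of_real_mult[symmetric]) simp
  ultimately show "w \<in> convex hull (ball 0 1 \<union> of_real ` {-2<..<2})"
    by (simp add: w_eq)
qed

section \<open>The lower bound\<close>

text \<open>
  Being equal to \<open>c\<close> on the window \<open>[-N, N]\<close> is an open condition, so some translate of \<open>b\<close>
  satisfies it.
\<close>
lemma long_constant_blocks:
  assumes "(\<lambda>_. c) \<in> subshift b"
  obtains p where "\<And>i. \<bar>i - p\<bar> \<le> N \<Longrightarrow> b i = c"
proof -
  let ?X = "\<lambda>i. if \<bar>i\<bar> \<le> N then {c} else {0, 1 :: nat}"
  have c: "(\<lambda>_. c) \<in> topspace binary_topology"
    using assms by (simp add: subshift_def in_closure_of)
  then have c01: "c \<in> {0, 1}"
    by (simp add: topspace_binary_topology)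
  have "{i. ?X i \<noteq> {0, 1}} \<subseteq> {-N..N}" by auto
  then have "finite {i. ?X i \<noteq> {0, 1}}"
    using finite_subset by blast
  then have "openin binary_topology (\<Pi>\<^sub>E i\<in>UNIV. ?X i)"
    unfolding binary_topology_def
    using c01 by (intro product_topology_basis) auto
  moreover have "(\<lambda>_. c) \<in> (\<Pi>\<^sub>E i\<in>UNIV. ?X i)"
    using c01 by auto
  ultimately obtain y where "y \<in> orbit b" and y: "y \<in> (\<Pi>\<^sub>E i\<in>UNIV. ?X i)"
    using assms unfolding subshift_def in_closure_of by blast
  then obtain n where n: "y = shift_power n b"
    by (auto simp: orbit_def)
  have "b i = c" if "\<bar>i - n\<bar> \<le> N" for i
  proof -
    have "y (i - n) \<in> ?X (i - n)" using y by blast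
    then show ?thesis using that by (simp add: n shift_power_apply)
  qed
  then show thesis using that by blast
qed

lemma convex_combination_in_numerical_range:
  assumes b: "range b \<subseteq> {0, 1}"
    and zeros: "(\<lambda>_. 0) \<in> subshift b" and ones: "(\<lambda>_. 1) \<in> subshift b"
    and u: "cmod u < 1" and v: "\<bar>v\<bar> < 2" and t: "0 \<le> t" "t \<le> 1"
  shows "of_real t * u + of_real (1 - t) * of_real v \<in> numerical_range (tridiag_op b)"
proof -
  obtain N where N: "\<And>p. \<exists>x. (\<forall>k. x k \<noteq> 0 \<longrightarrow> \<bar>k - p\<bar> < N) \<and>
      ((\<lambda>k. (cmod (x k))\<^sup>2) has_sum 1) UNIV \<and> (edge_product x has_sum u) UNIV"
    using finitely_supported_unit_vector[OF u] by blast
  have "\<bar>v / 2\<bar> < 1" using v by simp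
  then have "cmod (of_real (v / 2)) < 1" unfolding norm_of_real .
  then obtain M where M: "\<And>p. \<exists>x. (\<forall>k. x k \<noteq> 0 \<longrightarrow> \<bar>k - p\<bar> < M) \<and>
      ((\<lambda>k. (cmod (x k))\<^sup>2) has_sum 1) UNIV \<and> (edge_product x has_sum of_real (v / 2)) UNIV"
    using finitely_supported_unit_vector by blast
  obtain p where p: "\<And>i. \<bar>i - p\<bar> \<le> N \<Longrightarrow> b i = 0"
    using long_constant_blocks[OF zeros] by blast
  obtain q where q: "\<And>i. \<bar>i - q\<bar> \<le> M \<Longrightarrow> b i = 1"
    using long_constant_blocks[OF ones] by blast
  obtain x where x_supp: "\<And>k. x k \<noteq> 0 \<Longrightarrow> \<bar>k - p\<bar> < N"
    and x_unit: "((\<lambda>k. (cmod (x k))\<^sup>2) has_sum 1) UNIV"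
    and x_edges: "(edge_product x has_sum u) UNIV"
    using N[of p] by blast
  obtain y where y_supp: "\<And>k. y k \<noteq> 0 \<Longrightarrow> \<bar>k - q\<bar> < M"
    and y_unit: "((\<lambda>k. (cmod (y k))\<^sup>2) has_sum 1) UNIV"
    and y_edges: "(edge_product y has_sum of_real (v / 2)) UNIV"
    using M[of q] by blast
  \<comment> \<open>The blocks extend one position beyond the supports, so no edge joins the two supports.\<close>
  have bx: "b k = 0" "b (k + 1) = 0" if "x k \<noteq> 0" for k
    using x_supp[OF that] by (auto intro!: p)
  have yb: "b k = 1" "b (k + 1) = 1" if "y k \<noteq> 0" for k
    using y_supp[OF that] by (simp_all del: One_nat_def add: q)
  have disj: "x k = 0 \<or> y k = 0" "x (k + 1) = 0 \<or> y k = 0" "x k = 0 \<or> y (k + 1) = 0" for k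
    using bx[of k] bx(1)[of "k + 1"] yb[of k] yb(1)[of "k + 1"] by (metis zero_neq_one)+
  define z where "z k = of_real (sqrt t) * x k + of_real (sqrt (1 - t)) * y k" for k
  have sq: "complex_of_real (sqrt s) * of_real (sqrt s) = of_real s" if "0 \<le> s" for s
    using that by (simp flip: of_real_mult)
  have z_norm: "(cmod (z k))\<^sup>2 = t * (cmod (x k))\<^sup>2 + (1 - t) * (cmod (y k))\<^sup>2" for k
    using disj(1)[of k] t by (auto simp: z_def norm_mult power_mult_distrib)
  have "edge_product z k = (of_real (sqrt t) * of_real (sqrt t)) * edge_product x k
      + (of_real (sqrt (1 - t)) * of_real (sqrt (1 - t))) * edge_product y k" for k
    using disj(2,3)[of k] by (auto simp: edge_product_def z_def algebra_simps)
  then have z_edge: "edge_product z k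
      = of_real t * edge_product x k + of_real (1 - t) * edge_product y k" for k
    using t by (simp only: sq diff_ge_0_iff_ge)
  have bx0: "of_nat (b k) * cnj (edge_product x k) = 0" for k
    using bx(1)[of k] by (auto simp: edge_product_def)
  have by1: "of_nat (b k) * cnj (edge_product y k) = cnj (edge_product y k)" for k
    using yb(1)[of k] by (auto simp: edge_product_def)
  have z_form: "edge_product z k + of_nat (b k) * cnj (edge_product z k)
      = of_real t * edge_product x k
        + of_real (1 - t) * (edge_product y k + cnj (edge_product y k))" for k
  proof -
    have "of_nat (b k) * cnj (edge_product z k)
        = of_real t * (of_nat (b k) * cnj (edge_product x k))
          + of_real (1 - t) * (of_nat (b k) * cnj (edge_product y k))"
      unfolding z_edge by (simp add: algebra_simps)
    then show ?thesis
      unfolding bx0 by1 by (simp add: z_edge algebra_simps)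
  qed
  have "((\<lambda>k. t * (cmod (x k))\<^sup>2 + (1 - t) * (cmod (y k))\<^sup>2) has_sum (t * 1 + (1 - t) * 1)) UNIV"
    by (intro has_sum_add has_sum_cmult_right x_unit y_unit)
  then have z_unit: "((\<lambda>k. (cmod (z k))\<^sup>2) has_sum 1) UNIV"
    by (simp add: z_norm)
  have "((\<lambda>k. cnj (edge_product y k)) has_sum cnj (of_real (v / 2))) UNIV"
    using y_edges by (subst has_sum_cnj_iff)
  from has_sum_add[OF y_edges this]
  have "((\<lambda>k. edge_product y k + cnj (edge_product y k)) has_sum of_real v) UNIV"
    by simp
  then have "((\<lambda>k. edge_product z k + of_nat (b k) * cnj (edge_product z k))
      has_sum of_real t * u + of_real (1 - t) * of_real v) UNIV"
    unfolding z_form by (intro has_sum_add has_sum_cmult_right x_edges)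
  with z_unit show ?thesis
    using mem_numerical_range_iff[OF b] by blast
qed

theorem theorem2p7:
  fixes b :: "int \<Rightarrow> nat"
  assumes "range b \<subseteq> {0, 1}"
    and "(\<lambda>_. 0) \<in> subshift b"
    and "(\<lambda>_. 1) \<in> subshift b"
  shows "numerical_range (tridiag_op b) =
    convex hull (numerical_range (tridiag_op (\<lambda>_. 0)) \<union> numerical_range (tridiag_op (\<lambda>_. 1)))"
proof -
  let ?D = "ball (0::complex) 1" and ?I = "complex_of_real ` {-2<..<2}"
  have "convex ?I"
    by (intro convex_linear_image linear_of_real) simp
  then have hull: "convex hull (?D \<union> ?I) =
      {s *\<^sub>R u + t *\<^sub>R v | s t u v. s \<ge> 0 \<and> t \<ge> 0 \<and> s + t = 1 \<and> u \<in> ?D \<and> v \<in> ?I}"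
    by (intro convex_hull_union_two) auto
  have "convex hull (?D \<union> ?I) \<subseteq> numerical_range (tridiag_op b)"
  proof
    fix w assume "w \<in> convex hull (?D \<union> ?I)"
    then obtain s t u v where w: "w = s *\<^sub>R u + t *\<^sub>R of_real v"
      and st: "s \<ge> 0" "t \<ge> 0" "s + t = 1" and uv: "cmod u < 1" "-2 < v" "v < 2"
      unfolding hull by auto
    then have t: "t = 1 - s" by simp
    have "of_real s * u + of_real (1 - s) * of_real v \<in> numerical_range (tridiag_op b)"
      using st uv by (intro convex_combination_in_numerical_range assms) (auto simp: abs_less_iff)
    then show "w \<in> numerical_range (tridiag_op b)"
      unfolding w t scaleR_conv_of_real .
  qed
  with numerical_range_subset_convex_hull[OF assms(1)] show ?thesis
    unfolding numerical_range_const_0 numerical_range_const_1 by blast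
qed

end
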